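(* The solid conductor model $$M_\sigma\tfrac{\mathrm d}{\mathrm dt}a+K_\nu a-M_\sigma X_{\mathrm{sol}}\,v_{\mathrm{sol}}=0,\qquad -X_{\mathrm{sol}}^\top M_\sigma^\top\tfrac{\mathrm d}{\mathrm dt}a+G_{\mathrm{sol}}\,v_{\mathrm{sol}}-\imath_{\mathrm{sol}}=0,$$ with $G_{\mathrm{sol}}=X_{\mathrm{sol}}^\top M_\sigma X_{\mathrm{sol}}$, unknowns $a\colon[t_0,t_{\mathrm f}]\to\mathbb R^{n_w}$ and $v_{\mathrm{sol}}\colon[t_0,t_{\mathrm f}]\to\mathbb R^{n_{\mathrm{sol}}}$ and input $\imath_{\mathrm{sol}}\colon[t_0,t_{\mathrm f}]\to\mathbb R^{n_{\mathrm{sol}}}$, fits into the structure $$\begin{bmatrix}\nabla_{z_1}\mathcal H(z_1,z_2)\\ \frac{\mathrm d}{\mathrm dt}z_2\\ 0\end{bmatrix}=(\mathcal J-\mathcal R)\begin{bmatrix}\frac{\mathrm d}{\mathrm dt}z_1\\ \nabla_{z_2}\mathcal H(z_1,z_2)\\ z_3\end{bmatrix}+\mathcal B u$$ with $\mathcal J=-\mathcal J^\top$ and $\mathcal R=\mathcal R^\top$ positive semi-definite.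
   Context: "Fits into the structure" means: the unknowns of the model can be grouped into components $z_1,z_2,z_3$ (any of which may be absent) and, with $u$ the input of the model, there exist a function $\mathcal H\in C^1$ of $(z_1,z_2)$ and real constant matrices $\mathcal J=-\mathcal J^\top$, $\mathcal R=\mathcal R^\top\ge0$, $\mathcal B$ of appropriate sizes such that the model equations are equivalent to the displayed structured system. Matrices of the model. $\Omega\subset\mathbb R^3$ is a simply connected Lipschitz domain; $w_1,\dots,w_{n_w}$ are (vector-valued, edge-element) finite element basis functions on $\Omega$, lying in $H(\mathrm{curl};\Omega)$ with vanishing tangential trace; $\nu>0$ is a constant (reluctivity); the conductivity $\sigma$ equals a constant $\sigma_{\mathrm c}>0$ on a subdomain $\Omega_{\mathrm c}\subset\Omega$ and $0$ elsewhere. Then $$[M_\sigma]_{ij}=\int_\Omega\sigma\,w_j\cdot w_i\,\mathrm dV,\qquad [K_\nu]_{ij}=\int_\Omega\nu\,(\nabla\times w_j)\cdot(\nabla\times w_i)\,\mathrm dV .$$ It is assumed that (after gauging) the pencil $\lambda M_\sigma+K_\nu$ is regular. The solid conductor domains $\Omega_{\mathrm{sol},1},\dots,\Omega_{\mathrm{sol},n_{\mathrm{sol}}}$ are disjoint subdomains of $\Omega_{\mathrm c}$, with voltage distribution functions $\chi_{\mathrm{sol},k}\colon\Omega_{\mathrm{sol},k}\to\mathbb R^3$; the columns of $X_{\mathrm{sol}}\in\mathbb R^{n_w\times n_{\mathrm{sol}}}$ are the coefficient vectors of the discretized $\chi_{\mathrm{sol},k}$ with respect to the basis $(w_i)$.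 *)

theory Defs
  imports "HOL-Analysis.Analysis"
begin

definition gradient :: "('a::real_inner \<Rightarrow> real) \<Rightarrow> 'a \<Rightarrow> 'a" where
  "gradient H x = (THE D. GDERIV H x :> D)"

definition C1_function :: "('a::real_inner \<Rightarrow> real) \<Rightarrow> bool" where
  "C1_function H \<longleftrightarrow> (\<forall>x. \<exists>D. GDERIV H x :> D) \<and> continuous_on UNIV (gradient H)"

definition positive_semidefinite :: "real^'n^'n \<Rightarrow> bool" where
  "positive_semidefinite A \<longleftrightarrow> (\<forall>x. 0 \<le> x \<bullet> (A *v x))"

text \<open>
  All scalar unknowns are stacked into one vector in \<open>real^'i\<close>. A grouping \<open>\<gamma>\<close> sends each
  coordinate to the component \<open>z\<^sub>1\<close>, \<open>z\<^sub>2\<close> or \<open>z\<^sub>3\<close> that contains it. A component is absent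
  if no coordinate is sent to it, and the component sizes need not appear as (nonzero) type
  dimensions. The block matrices \<open>\<J>\<close>, \<open>\<R>\<close>, \<open>\<B>\<close> have their rows, and \<open>\<J>\<close>, \<open>\<R>\<close> their columns,
  indexed by the same coordinates.
\<close>

datatype component = Z1 | Z2 | Z3

text \<open>A function of \<open>(z\<^sub>1,z\<^sub>2)\<close> is a function of the stacked vector that ignores \<open>z\<^sub>3\<close>;
  coordinate \<open>i\<close> of its gradient is then the partial derivative in that coordinate.\<close>

definition depends_on_z1_z2 :: "('i::finite \<Rightarrow> component) \<Rightarrow> (real^'i \<Rightarrow> real) \<Rightarrow> bool" where
  "depends_on_z1_z2 \<gamma> H \<longleftrightarrow>
     (\<forall>x y. (\<forall>i. \<gamma> i \<noteq> Z3 \<longrightarrow> x $ i = y $ i) \<longrightarrow> H x = H y)"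

text \<open>The left-hand side \<open>(\<nabla>\<^bsub>z\<^sub>1\<^esub>H, dz\<^sub>2/dt, 0)\<close> and the vector
  \<open>(dz\<^sub>1/dt, \<nabla>\<^bsub>z\<^sub>2\<^esub>H, z\<^sub>3)\<close> multiplied by \<open>\<J> - \<R>\<close>.\<close>

definition structure_lhs ::
  "('i::finite \<Rightarrow> component) \<Rightarrow> (real^'i \<Rightarrow> real) \<Rightarrow> real^'i \<Rightarrow> real^'i \<Rightarrow> real^'i" where
  "structure_lhs \<gamma> H z z' = (\<chi> i. case \<gamma> i of
      Z1 \<Rightarrow> gradient H z $ i | Z2 \<Rightarrow> z' $ i | Z3 \<Rightarrow> 0)"

definition structure_rhs ::
  "('i::finite \<Rightarrow> component) \<Rightarrow> (real^'i \<Rightarrow> real) \<Rightarrow> real^'i \<Rightarrow> real^'i \<Rightarrow> real^'i" where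
  "structure_rhs \<gamma> H z z' = (\<chi> i. case \<gamma> i of
      Z1 \<Rightarrow> z' $ i | Z2 \<Rightarrow> gradient H z $ i | Z3 \<Rightarrow> z $ i)"

text \<open>Solutions are classical on \<open>[t\<^sub>0,t\<^sub>f]\<close>: exactly the quantities that occur differentiated, here
  \<open>z\<^sub>1\<close> and \<open>z\<^sub>2\<close>, are required to be differentiable (one-sidedly at the end points). The values of
  \<open>z'\<close> in the coordinates of \<open>z\<^sub>3\<close> are not used.\<close>

definition structured_system ::
  "real \<Rightarrow> real \<Rightarrow> ('i::finite \<Rightarrow> component) \<Rightarrow> (real^'i \<Rightarrow> real) \<Rightarrow> real^'i^'i \<Rightarrow> real^'i^'i \<Rightarrow>
   real^'u^'i \<Rightarrow> (real \<Rightarrow> real^'i) \<Rightarrow> (real \<Rightarrow> real^'u) \<Rightarrow> bool" where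
  "structured_system t0 tf \<gamma> H J R B z u \<longleftrightarrow>
     (\<exists>z'. \<forall>t\<in>{t0..tf}.
        (\<forall>i. \<gamma> i \<noteq> Z3 \<longrightarrow>
           ((\<lambda>s. z s $ i) has_real_derivative z' t $ i) (at t within {t0..tf})) \<and>
        structure_lhs \<gamma> H (z t) (z' t) = (J - R) *v structure_rhs \<gamma> H (z t) (z' t) + B *v u t)"

text \<open>A model is given by its solution relation between stacked unknowns and inputs. The map \<open>blk\<close>
  names the (vector-valued) unknown to which each coordinate belongs; unknowns are assigned to
  components as a whole. Equivalence of the equations means that they have the same solutions.\<close>

definition fits_into_structure ::
  "real \<Rightarrow> real \<Rightarrow> ('i::finite \<Rightarrow> 'b) \<Rightarrow> ((real \<Rightarrow> real^'i) \<Rightarrow> (real \<Rightarrow> real^'u) \<Rightarrow> bool) \<Rightarrow> bool" where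
  "fits_into_structure t0 tf blk model \<longleftrightarrow>
     (\<exists>(grp :: 'b \<Rightarrow> component) H J R (B :: real^'u^'i).
        depends_on_z1_z2 (grp \<circ> blk) H \<and> C1_function H \<and>
        J = - transpose J \<and> R = transpose R \<and> positive_semidefinite R \<and>
        (\<forall>z u. model z u \<longleftrightarrow> structured_system t0 tf (grp \<circ> blk) H J R B z u))"

text \<open>Near each boundary point, \<open>\<Omega>\<close> is the set below the graph of a Lipschitz function over a plane
  orthogonal to some unit vector \<open>e\<close>.\<close>

definition lipschitz_domain :: "(real^3) set \<Rightarrow> bool" where
  "lipschitz_domain \<Omega> \<longleftrightarrow> open \<Omega> \<and> connected \<Omega> \<and> \<Omega> \<noteq> {} \<and>
     (\<forall>p\<in>frontier \<Omega>. \<exists>U e g L. open U \<and> p \<in> U \<and> norm e = 1 \<and> L-lipschitz_on UNIV (g :: real^3 \<Rightarrow> real) \<and>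
        \<Omega> \<inter> U = {x\<in>U. e \<bullet> x < g (x - (e \<bullet> x) *\<^sub>R e)})"

definition subdomain :: "(real^3) set \<Rightarrow> (real^3) set \<Rightarrow> bool" where
  "subdomain D \<Omega> \<longleftrightarrow> open D \<and> D \<noteq> {} \<and> D \<subseteq> \<Omega>"

text \<open>Fields on \<open>\<Omega>\<close> are total functions whose values outside \<open>\<Omega>\<close> are irrelevant.\<close>

primrec Ck_field :: "nat \<Rightarrow> (real^3 \<Rightarrow> real^3) \<Rightarrow> bool" where
  "Ck_field 0 f = continuous_on UNIV f"
| "Ck_field (Suc k) f =
     (\<exists>f'. (\<forall>x. (f has_derivative f' x) (at x)) \<and> (\<forall>h. Ck_field k (\<lambda>x. f' x h)))"

definition test_field :: "(real^3) set \<Rightarrow> (real^3 \<Rightarrow> real^3) \<Rightarrow> bool" where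
  "test_field U \<phi> \<longleftrightarrow> (\<forall>k. Ck_field k \<phi>) \<and>
     compact (closure {x. \<phi> x \<noteq> 0}) \<and> closure {x. \<phi> x \<noteq> 0} \<subseteq> U"

definition partial_deriv :: "3 \<Rightarrow> 3 \<Rightarrow> (real^3 \<Rightarrow> real^3) \<Rightarrow> real^3 \<Rightarrow> real" where
  "partial_deriv i j \<phi> x = frechet_derivative \<phi> (at x) (axis i 1) $ j"

definition classical_curl :: "(real^3 \<Rightarrow> real^3) \<Rightarrow> real^3 \<Rightarrow> real^3" where
  "classical_curl \<phi> x = vector
     [partial_deriv 2 3 \<phi> x - partial_deriv 3 2 \<phi> x,
      partial_deriv 3 1 \<phi> x - partial_deriv 1 3 \<phi> x,
      partial_deriv 1 2 \<phi> x - partial_deriv 2 1 \<phi> x]"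

definition L2_field :: "(real^3) set \<Rightarrow> (real^3 \<Rightarrow> real^3) \<Rightarrow> bool" where
  "L2_field \<Omega> f \<longleftrightarrow> f \<in> borel_measurable (lebesgue_on \<Omega>) \<and>
     integrable (lebesgue_on \<Omega>) (\<lambda>x. (norm (f x))\<^sup>2)"

definition is_weak_curl :: "(real^3) set \<Rightarrow> (real^3 \<Rightarrow> real^3) \<Rightarrow> (real^3 \<Rightarrow> real^3) \<Rightarrow> bool" where
  "is_weak_curl \<Omega> f g \<longleftrightarrow> L2_field \<Omega> g \<and>
     (\<forall>\<phi>. test_field \<Omega> \<phi> \<longrightarrow>
        (LINT x|lebesgue_on \<Omega>. g x \<bullet> \<phi> x) = (LINT x|lebesgue_on \<Omega>. f x \<bullet> classical_curl \<phi> x))"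

definition H_curl :: "(real^3) set \<Rightarrow> (real^3 \<Rightarrow> real^3) set" where
  "H_curl \<Omega> = {f. L2_field \<Omega> f \<and> (\<exists>g. is_weak_curl \<Omega> f g)}"

text \<open>The weak curl is unique up to null sets, so integrals do not depend on the choice.\<close>

definition curl :: "(real^3) set \<Rightarrow> (real^3 \<Rightarrow> real^3) \<Rightarrow> real^3 \<Rightarrow> real^3" where
  "curl \<Omega> f = (SOME g. is_weak_curl \<Omega> f g)"

text \<open>The tangential trace of a field in \<open>H(curl;\<Omega>)\<close> is the functional on boundary values given by
  Green's formula, \<open>\<phi> \<mapsto> \<integral>\<^sub>\<Omega> curl f \<bullet> \<phi> - f \<bullet> curl \<phi>\<close> (for smooth \<open>f\<close> this is the boundary
  integral of \<open>(n \<times> f) \<bullet> \<phi>\<close>); here \<open>\<phi>\<close> need not vanish on the boundary.\<close>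

definition tangential_trace :: "(real^3) set \<Rightarrow> (real^3 \<Rightarrow> real^3) \<Rightarrow> (real^3 \<Rightarrow> real^3) \<Rightarrow> real" where
  "tangential_trace \<Omega> f \<phi> =
     (LINT x|lebesgue_on \<Omega>. curl \<Omega> f x \<bullet> \<phi> x) - (LINT x|lebesgue_on \<Omega>. f x \<bullet> classical_curl \<phi> x)"

definition vanishing_tangential_trace :: "(real^3) set \<Rightarrow> (real^3 \<Rightarrow> real^3) \<Rightarrow> bool" where
  "vanishing_tangential_trace \<Omega> f \<longleftrightarrow> (\<forall>\<phi>. test_field UNIV \<phi> \<longrightarrow> tangential_trace \<Omega> f \<phi> = 0)"

definition lin_indep_fields :: "(real^3) set \<Rightarrow> ('w::finite \<Rightarrow> real^3 \<Rightarrow> real^3) \<Rightarrow> bool" where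
  "lin_indep_fields \<Omega> w \<longleftrightarrow>
     (\<forall>c :: real^'w. (AE x in lebesgue_on \<Omega>. (\<Sum>i\<in>UNIV. (c $ i) *\<^sub>R w i x) = 0) \<longrightarrow> c = 0)"

definition conductivity :: "(real^3) set \<Rightarrow> real \<Rightarrow> real^3 \<Rightarrow> real" where
  "conductivity \<Omega>c \<sigma>c x = (if x \<in> \<Omega>c then \<sigma>c else 0)"

definition mass_matrix ::
  "(real^3) set \<Rightarrow> (real^3 \<Rightarrow> real) \<Rightarrow> ('w::finite \<Rightarrow> real^3 \<Rightarrow> real^3) \<Rightarrow> real^'w^'w" where
  "mass_matrix \<Omega> \<sigma> w = (\<chi> i j. LINT x|lebesgue_on \<Omega>. \<sigma> x * (w j x \<bullet> w i x))"

definition curl_curl_matrix ::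
  "(real^3) set \<Rightarrow> real \<Rightarrow> ('w::finite \<Rightarrow> real^3 \<Rightarrow> real^3) \<Rightarrow> real^'w^'w" where
  "curl_curl_matrix \<Omega> \<nu> w = (\<chi> i j. LINT x|lebesgue_on \<Omega>. \<nu> * (curl \<Omega> (w j) x \<bullet> curl \<Omega> (w i) x))"

definition regular_pencil :: "real^'n^'n \<Rightarrow> real^'n^'n \<Rightarrow> bool" where
  "regular_pencil M K \<longleftrightarrow>
     (\<exists>s::complex. det (\<chi> i j. s * complex_of_real (M $ i $ j) + complex_of_real (K $ i $ j)) \<noteq> 0)"

definition solid_conductor_model ::
  "real \<Rightarrow> real \<Rightarrow> real^'w^'w \<Rightarrow> real^'w^'w \<Rightarrow> real^'s^'w \<Rightarrow>
   (real \<Rightarrow> real^'w) \<Rightarrow> (real \<Rightarrow> real^'s) \<Rightarrow> (real \<Rightarrow> real^'s) \<Rightarrow> bool" where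
  "solid_conductor_model t0 tf M K X a v \<iota> \<longleftrightarrow>
     (let G = transpose X ** M ** X in
      \<exists>a'. \<forall>t\<in>{t0..tf}.
        (a has_vector_derivative a' t) (at t within {t0..tf}) \<and>
        M *v a' t + K *v a t - (M ** X) *v v t = 0 \<and>
        - ((transpose X ** transpose M) *v a' t) + G *v v t - \<iota> t = 0)"

datatype unknown = Unknown_a | Unknown_v

definition solid_unknown :: "'w + 's \<Rightarrow> unknown" where
  "solid_unknown i = (case i of Inl _ \<Rightarrow> Unknown_a | Inr _ \<Rightarrow> Unknown_v)"

definition a_part :: "real^('w::finite + 's::finite) \<Rightarrow> real^'w" where
  "a_part z = (\<chi> i. z $ Inl i)"

definition v_part :: "real^('w::finite + 's::finite) \<Rightarrow> real^'s" where
  "v_part z = (\<chi> k. z $ Inr k)"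

end

theory Submission
  imports Defs
begin

text \<open>
  Group \<open>a\<close> as \<open>z\<^sub>1\<close> and \<open>v\<close> as \<open>z\<^sub>3\<close>, and take the magnetic energy \<open>H = a\<^sup>T K a / 2\<close>. Solving the
  first equation for \<open>K a = \<nabla>H\<close> and changing the sign of the second one gives the structure with
  \<open>J = 0\<close>, \<open>B = [0; I]\<close> and \<open>R = [M, -M X; -X\<^sup>T M, X\<^sup>T M X] = [I, -X]\<^sup>T M [I, -X]\<close>, which is positive
  semi-definite because \<open>M\<close> is a weighted Gram matrix with nonnegative weight.
\<close>

section \<open>Block matrices acting on stacked vectors\<close>

definition block_matrix ::
  "real^'w^'w \<Rightarrow> real^'s^'w \<Rightarrow> real^'w^'s \<Rightarrow> real^'s^'s \<Rightarrow> real^('w::finite + 's::finite)^('w + 's)" where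
  "block_matrix A B C D = (\<chi> p q. case p of
      Inl i \<Rightarrow> (case q of Inl j \<Rightarrow> A $ i $ j | Inr l \<Rightarrow> B $ i $ l)
    | Inr k \<Rightarrow> (case q of Inl j \<Rightarrow> C $ k $ j | Inr l \<Rightarrow> D $ k $ l))"

lemma sum_UNIV_Plus:
  "(\<Sum>p\<in>UNIV. f p) = (\<Sum>i\<in>UNIV. f (Inl i)) + (\<Sum>k\<in>UNIV. f (Inr k))"
  for f :: "'w::finite + 's::finite \<Rightarrow> 'b::comm_monoid_add"
proof -
  have "(\<Sum>p\<in>UNIV. f p) = (\<Sum>p\<in>UNIV <+> UNIV. f p)" by simp
  also have "\<dots> = (\<Sum>i\<in>UNIV. f (Inl i)) + (\<Sum>k\<in>UNIV. f (Inr k))"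
    by (subst sum.Plus) auto
  finally show ?thesis .
qed

lemma block_matrix_vector_mult_Inl:
  "(block_matrix A B C D *v z) $ Inl i = (A *v a_part z + B *v v_part z) $ i"
  by (simp add: matrix_vector_mult_def block_matrix_def sum_UNIV_Plus a_part_def v_part_def)

lemma block_matrix_vector_mult_Inr:
  "(block_matrix A B C D *v z) $ Inr k = (C *v a_part z + D *v v_part z) $ k"
  by (simp add: matrix_vector_mult_def block_matrix_def sum_UNIV_Plus a_part_def v_part_def)

lemma inner_block_matrix_vector_mult:
  "y \<bullet> (block_matrix A B C D *v z) =
     a_part y \<bullet> (A *v a_part z + B *v v_part z) + v_part y \<bullet> (C *v a_part z + D *v v_part z)"
  unfolding inner_vec_def sum_UNIV_Plus block_matrix_vector_mult_Inl block_matrix_vector_mult_Inr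
  by (simp add: a_part_def v_part_def)

lemma transpose_block_matrix:
  "transpose (block_matrix A B C D) =
     block_matrix (transpose A) (transpose C) (transpose B) (transpose D)"
  by (simp add: vec_eq_iff transpose_def block_matrix_def split: sum.split)

section \<open>Quadratic forms and their gradients\<close>

lemma GDERIV_quadratic_form:
  fixes A :: "real^'n^'n"
  assumes "transpose A = A"
  shows "GDERIV (\<lambda>x. (x \<bullet> (A *v x)) / 2) x :> A *v x"
proof -
  \<comment> \<open>Symmetry makes the two terms of the product rule equal, which cancels the factor
    1/2.\<close>
  have sym: "x \<bullet> (A *v h) = h \<bullet> (A *v x)" for h
    by (metis assms dot_lmul_matrix inner_commute vector_transpose_matrix)
  have "((\<lambda>x. (x \<bullet> (A *v x)) / 2) has_derivative (\<lambda>h. (x \<bullet> (A *v h) + h \<bullet> (A *v x)) / 2)) (at x)"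
    by (auto intro!: derivative_eq_intros
        bounded_linear.has_derivative[OF matrix_vector_mul_bounded_linear])
  then show ?thesis
    by (simp add: gderiv_def sym)
qed

text \<open>Resolves the \<open>THE\<close> in \<open>gradient\<close>: Frechet derivatives are
  unique, and a vector is determined by its inner products with all vectors.\<close>

lemma gradient_eqI:
  assumes "GDERIV f x :> D"
  shows "gradient f x = D"
  unfolding gradient_def
proof (rule the_equality[where a = D])
  fix E assume "GDERIV f x :> E"
  then have "(\<lambda>h. h \<bullet> E) = (\<lambda>h. h \<bullet> D)"
    using assms has_derivative_unique unfolding gderiv_def by blast
  then show "E = D"
    by (metis vector_eq_ldot)
qed (fact assms)

lemma gradient_quadratic_form:
  fixes A :: "real^'n^'n"
  assumes "transpose A = A"
  shows "gradient (\<lambda>x. (x \<bullet> (A *v x)) / 2) = (\<lambda>x. A *v x)"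
  using gradient_eqI[OF GDERIV_quadratic_form[OF assms]] by blast

lemma C1_function_quadratic_form:
  fixes A :: "real^'n^'n"
  assumes "transpose A = A"
  shows "C1_function (\<lambda>x. (x \<bullet> (A *v x)) / 2)"
  unfolding C1_function_def gradient_quadratic_form[OF assms]
  using GDERIV_quadratic_form[OF assms] matrix_vector_mult_linear_continuous_on by blast

section \<open>Finite element matrices: integrability, symmetry, positivity\<close>

lemma integrable_weighted_inner:
  fixes f g :: "'a \<Rightarrow> 'b::euclidean_space" and \<sigma> :: "'a \<Rightarrow> real"
  assumes f: "f \<in> borel_measurable N" "integrable N (\<lambda>x. (norm (f x))\<^sup>2)"
    and g: "g \<in> borel_measurable N" "integrable N (\<lambda>x. (norm (g x))\<^sup>2)"
    and \<sigma>: "\<sigma> \<in> borel_measurable N" "\<And>x. \<bar>\<sigma> x\<bar> \<le> C"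
  shows "integrable N (\<lambda>x. \<sigma> x * (f x \<bullet> g x))"
proof (rule Bochner_Integration.integrable_bound)
  \<comment> \<open>This majorant comes from Cauchy-Schwarz followed by pq \<le> p^2 + q^2 for the
    norms p, q.\<close>
  show "integrable N (\<lambda>x. C * ((norm (f x))\<^sup>2 + (norm (g x))\<^sup>2))"
    using f(2) g(2) by simp
  show "(\<lambda>x. \<sigma> x * (f x \<bullet> g x)) \<in> borel_measurable N"
    using f(1) g(1) \<sigma>(1) by measurable
  have "norm (\<sigma> x * (f x \<bullet> g x)) \<le> norm (C * ((norm (f x))\<^sup>2 + (norm (g x))\<^sup>2))" for x
  proof -
    have "\<bar>f x \<bullet> g x\<bar> \<le> norm (f x) * norm (g x)"
      by (rule Cauchy_Schwarz_ineq2)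
    also have "\<dots> \<le> (norm (f x))\<^sup>2 + (norm (g x))\<^sup>2"
      using sum_squares_bound[of "norm (f x)" "norm (g x)"]
        mult_nonneg_nonneg[OF norm_ge_zero norm_ge_zero, of "f x" "g x"] by linarith
    \<comment> \<open>The bound on \<sigma> also yields \<open>0 \<le> C\<close>, as monotonicity of
      the product requires.\<close>
    finally have "\<bar>\<sigma> x\<bar> * \<bar>f x \<bullet> g x\<bar> \<le> C * ((norm (f x))\<^sup>2 + (norm (g x))\<^sup>2)"
      using \<sigma>(2)[of x] by (intro mult_mono) auto
    also have "\<dots> \<le> norm (C * ((norm (f x))\<^sup>2 + (norm (g x))\<^sup>2))"
      by simp
    finally show ?thesis by (simp add: abs_mult)
  qed
  then show "AE x in N. norm (\<sigma> x * (f x \<bullet> g x)) \<le> norm (C * ((norm (f x))\<^sup>2 + (norm (g x))\<^sup>2))"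
    by simp
qed

lemma transpose_mass_matrix: "transpose (mass_matrix \<Omega> \<sigma> w) = mass_matrix \<Omega> \<sigma> w"
  by (simp add: vec_eq_iff transpose_def mass_matrix_def inner_commute)

lemma transpose_curl_curl_matrix: "transpose (curl_curl_matrix \<Omega> \<nu> w) = curl_curl_matrix \<Omega> \<nu> w"
  by (simp add: vec_eq_iff transpose_def curl_curl_matrix_def inner_commute)

lemma positive_semidefinite_mass_matrix:
  assumes w: "\<And>i. L2_field \<Omega> (w i)"
    and \<sigma>: "\<sigma> \<in> borel_measurable (lebesgue_on \<Omega>)" "\<And>x. 0 \<le> \<sigma> x" "\<And>x. \<sigma> x \<le> C"
  shows "positive_semidefinite (mass_matrix \<Omega> \<sigma> w)"
  unfolding positive_semidefinite_def
proof
  fix c :: "real^'a"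
  \<comment> \<open>Integrability of every entry is what allows the finite sums to move under the
    integral.\<close>
  have int: "integrable (lebesgue_on \<Omega>) (\<lambda>x. \<sigma> x * (w j x \<bullet> w i x))" for i j
    using w \<sigma> unfolding L2_field_def by (intro integrable_weighted_inner[where C = C]) auto
  have "c \<bullet> (mass_matrix \<Omega> \<sigma> w *v c) =
      (\<Sum>i\<in>UNIV. \<Sum>j\<in>UNIV. c $ i * (c $ j * (LINT x|lebesgue_on \<Omega>. \<sigma> x * (w j x \<bullet> w i x))))"
    by (simp add: inner_vec_def[of c] matrix_vector_mult_def mass_matrix_def sum_distrib_left mult_ac)
  also have "\<dots> = (LINT x|lebesgue_on \<Omega>.
      (\<Sum>i\<in>UNIV. \<Sum>j\<in>UNIV. c $ i * (c $ j * (\<sigma> x * (w j x \<bullet> w i x)))))"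
    using int by (simp add: Bochner_Integration.integral_sum)
  \<comment> \<open>The double sum collapses to \<sigma> times the squared norm of the field with
    coefficients \<open>c\<close>, which is pointwise nonnegative.\<close>
  also have "\<dots> = (LINT x|lebesgue_on \<Omega>. \<sigma> x *
      ((\<Sum>i\<in>UNIV. c $ i *\<^sub>R w i x) \<bullet> (\<Sum>j\<in>UNIV. c $ j *\<^sub>R w j x)))"
    by (intro Bochner_Integration.integral_cong)
      (simp_all add: inner_sum_left inner_sum_right sum_distrib_left mult_ac inner_commute)
  also have "\<dots> \<ge> 0"
    using \<sigma>(2) by (intro integral_nonneg_AE) simp
  finally show "0 \<le> c \<bullet> (mass_matrix \<Omega> \<sigma> w *v c)" .
qed

text \<open>A step function on a Borel set is Borel, hence measurable for the completion (Lebesgue)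
  and for its restriction to \<Omega>.\<close>

lemma borel_measurable_conductivity:
  assumes "open \<Omega>" "open \<Omega>c"
  shows "conductivity \<Omega>c \<sigma>c \<in> borel_measurable (lebesgue_on \<Omega>)"
proof -
  have [measurable]: "\<Omega>c \<in> sets borel"
    using assms(2) by simp
  have "conductivity \<Omega>c \<sigma>c \<in> borel_measurable borel"
    unfolding conductivity_def[abs_def] by measurable
  then show ?thesis
    by (intro measurable_restrict_space1 measurable_completion) simp
qed

section \<open>The dissipation matrix\<close>

definition solid_dissipation :: "real^'w^'w \<Rightarrow> real^'s^'w \<Rightarrow> real^('w::finite + 's::finite)^('w + 's)" where
  "solid_dissipation M X =
     block_matrix M (- (M ** X)) (- (transpose X ** M)) (transpose X ** M ** X)"

lemma matrix_minus_left: "(- A) *v x = - (A *v x)" for A :: "real^'n^'m"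
  by (simp add: matrix_vector_mult_def vec_eq_iff sum_negf)

lemma transpose_uminus: "transpose (- A) = - transpose A" for A :: "real^'n^'m"
  by (simp add: vec_eq_iff transpose_def)

text \<open>For symmetric \<open>M\<close> the off-diagonal blocks are transposes of each other, and
  \<open>transpose X ** M ** X\<close> is symmetric.\<close>

lemma transpose_solid_dissipation:
  assumes "transpose M = M"
  shows "transpose (solid_dissipation M X) = solid_dissipation M X"
  unfolding solid_dissipation_def transpose_block_matrix
  by (simp add: assms transpose_uminus matrix_transpose_mul matrix_mul_assoc)

lemma positive_semidefinite_solid_dissipation:
  assumes "positive_semidefinite M"
  shows "positive_semidefinite (solid_dissipation M X)"
  unfolding positive_semidefinite_def
proof
  fix z
  \<comment> \<open>This is \<open>[I, -X]\<close> applied to \<open>z\<close>; by the factorization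
    of the block matrix its quadratic form at \<open>z\<close> is that of \<open>M\<close> at
    \<open>y\<close>.\<close>
  define y where "y = a_part z - X *v v_part z"
  \<comment> \<open>Adjointness in terms of \<open>v*\<close>, used to move \<open>X\<close> across
    the inner product.\<close>
  have tr: "u \<bullet> (x v* X) = (X *v u) \<bullet> x" for u x
    by (metis dot_lmul_matrix inner_commute)
  have "z \<bullet> (solid_dissipation M X *v z) = y \<bullet> (M *v y)"
    unfolding solid_dissipation_def inner_block_matrix_vector_mult y_def
    by (simp add: matrix_minus_left matrix_vector_mul_assoc[symmetric] tr inner_diff_left
        inner_diff_right inner_add_right matrix_vector_mult_diff_distrib)
  then show "0 \<le> z \<bullet> (solid_dissipation M X *v z)"
    using assms by (simp add: positive_semidefinite_def)
qed

section \<open>Data of the structured system and equivalence of the equations\<close>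

definition solid_grouping :: "unknown \<Rightarrow> component" where
  "solid_grouping b = (case b of Unknown_a \<Rightarrow> Z1 | Unknown_v \<Rightarrow> Z3)"

lemma solid_grouping_simps [simp]:
  "solid_grouping (solid_unknown (Inl i)) = Z1"
  "solid_grouping (solid_unknown (Inr k)) = Z3"
  by (simp_all add: solid_grouping_def solid_unknown_def)

text \<open>Padding \<open>K\<close> by zero blocks turns the energy of \<open>a\<close> into a
  function of the whole stacked vector that is constant in the \<open>v\<close> coordinates.\<close>

definition solid_energy_matrix :: "real^'w^'w \<Rightarrow> real^('w::finite + 's::finite)^('w + 's)" where
  "solid_energy_matrix K = block_matrix K 0 0 0"

definition solid_input_matrix :: "real^'s^('w::finite + 's::finite)" where
  "solid_input_matrix = (\<chi> p k. case p of Inl i \<Rightarrow> 0 | Inr l \<Rightarrow> mat 1 $ l $ k)"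

lemma solid_input_matrix_vector_mult [simp]:
  "(solid_input_matrix *v u) $ Inl i = 0"
  "(solid_input_matrix *v u) $ Inr k = u $ k"
proof -
  have "(solid_input_matrix *v u) $ Inr k = (mat 1 *v u) $ k"
    by (simp add: solid_input_matrix_def matrix_vector_mult_def)
  then show "(solid_input_matrix *v u) $ Inr k = u $ k"
    by simp
qed (simp add: solid_input_matrix_def matrix_vector_mult_def)

lemma transpose_zero: "transpose (0 :: 'b::zero^'n^'m) = 0"
  by (simp add: transpose_def vec_eq_iff)

lemma transpose_solid_energy_matrix:
  assumes "transpose K = K"
  shows "transpose (solid_energy_matrix K) = solid_energy_matrix K"
  by (simp add: solid_energy_matrix_def transpose_block_matrix transpose_zero assms)

lemma vec_eq_iff_Plus:
  "x = y \<longleftrightarrow> (\<forall>i. x $ Inl i = y $ Inl i) \<and> (\<forall>k. x $ Inr k = y $ Inr k)"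
  for x y :: "'b^('w::finite + 's::finite)"
  by (metis vec_eq_iff sum.exhaust)

text \<open>The algebraic part at a fixed time, with \<open>z'\<close> in place of the derivative.
  The \<open>Inl\<close> rows are the first equation solved for \<open>K *v a_part z\<close>; the
  \<open>Inr\<close> rows are the second with opposite sign, where symmetry identifies
  \<open>transpose M\<close> with \<open>M\<close>.\<close>

lemma structure_equation_iff:
  fixes z z' :: "real^('w::finite + 's::finite)"
  assumes M: "transpose M = M" and K: "transpose K = K"
  defines "H \<equiv> \<lambda>x :: real^('w + 's). (x \<bullet> (solid_energy_matrix K *v x)) / 2"
    and "\<gamma> \<equiv> solid_grouping \<circ> solid_unknown"
  shows "structure_lhs \<gamma> H z z' =
      (0 - solid_dissipation M X) *v structure_rhs \<gamma> H z z' + solid_input_matrix *v u \<longleftrightarrow>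
    M *v a_part z' + K *v a_part z - (M ** X) *v v_part z = 0 \<and>
    - ((transpose X ** transpose M) *v a_part z') + (transpose X ** M ** X) *v v_part z - u = 0"
proof -
  have grad: "gradient H = (\<lambda>x. solid_energy_matrix K *v x)"
    unfolding H_def by (intro gradient_quadratic_form transpose_solid_energy_matrix K)
  have parts: "a_part (structure_rhs \<gamma> H z z') = a_part z'"
    "v_part (structure_rhs \<gamma> H z z') = v_part z"
    by (simp_all add: vec_eq_iff a_part_def v_part_def structure_rhs_def \<gamma>_def)
  have lhs: "structure_lhs \<gamma> H z z' $ Inl i = (K *v a_part z) $ i"
    "structure_lhs \<gamma> H z z' $ Inr k = 0" for i k
    by (simp_all add: structure_lhs_def \<gamma>_def grad solid_energy_matrix_def
        block_matrix_vector_mult_Inl)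
  show ?thesis
    unfolding vec_eq_iff_Plus[of "structure_lhs \<gamma> H z z'"]
    by (auto simp: lhs matrix_minus_left solid_dissipation_def block_matrix_vector_mult_Inl
        block_matrix_vector_mult_Inr parts M vec_eq_iff algebra_simps)
qed

lemma solid_conductor_model_iff_structured_system:
  fixes z :: "real \<Rightarrow> real^('w::finite + 's::finite)"
  assumes M: "transpose M = M" and K: "transpose K = K"
  shows "solid_conductor_model t0 tf M K X (\<lambda>t. a_part (z t)) (\<lambda>t. v_part (z t)) u \<longleftrightarrow>
    structured_system t0 tf (solid_grouping \<circ> solid_unknown)
      (\<lambda>x. (x \<bullet> (solid_energy_matrix K *v x)) / 2) 0 (solid_dissipation M X) solid_input_matrix z u"
    (is "?model \<longleftrightarrow> ?system")
proof -
  \<comment> \<open>The coordinates not sent to \<open>Z3\<close> are exactly those of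
    \<open>a\<close>, and differentiability of a vector function is componentwise.\<close>
  have deriv: "(\<forall>p. (solid_grouping \<circ> solid_unknown) p \<noteq> Z3 \<longrightarrow>
        ((\<lambda>s. z s $ p) has_real_derivative z' $ p) (at t within S)) \<longleftrightarrow>
      ((\<lambda>s. a_part (z s)) has_vector_derivative a_part z') (at t within S)" for z' t S
  proof -
    have "(\<forall>p. (solid_grouping \<circ> solid_unknown) p \<noteq> Z3 \<longrightarrow>
        ((\<lambda>s. z s $ p) has_real_derivative z' $ p) (at t within S)) \<longleftrightarrow>
      (\<forall>i. ((\<lambda>s. a_part (z s) $ i) has_vector_derivative a_part z' $ i) (at t within S))"
      by (auto simp: a_part_def has_real_derivative_iff_has_vector_derivative
          split_sum_all)
    also have "\<dots> \<longleftrightarrow> ((\<lambda>s. a_part (z s)) has_vector_derivative a_part z') (at t within S)"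
      by (simp add: has_vector_derivative_def has_derivative_componentwise_within[of "\<lambda>s. a_part (z s)"]
          Basis_vec_def inner_axis)
    finally show ?thesis .
  qed
  \<comment> \<open>The model quantifies over derivatives of \<open>a\<close>, the structure over
    stacked \<open>z'\<close>. Padding by zeros extends any \<open>a'\<close> to such a
    \<open>z'\<close>; conversely \<open>a_part\<close> recovers \<open>a'\<close>.\<close>
  have surj: "\<exists>z'::real \<Rightarrow> real^('w + 's). \<forall>t. a_part (z' t) = a' t" for a' :: "real \<Rightarrow> real^'w"
    by (rule exI[of _ "\<lambda>t. \<chi> p. case p of Inl i \<Rightarrow> a' t $ i | Inr k \<Rightarrow> 0"])
      (simp add: a_part_def vec_eq_iff)
  show ?thesis
    unfolding solid_conductor_model_def structured_system_def Let_def deriv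
      structure_equation_iff[OF M K]
    by (metis surj)
qed

theorem theorem13:
  fixes \<Omega> \<Omega>c :: "(real^3) set"
    and \<Omega>sol :: "'s::finite \<Rightarrow> (real^3) set"
    and w :: "'w::finite \<Rightarrow> real^3 \<Rightarrow> real^3"
    and \<nu> \<sigma>c t0 tf :: real
    and chi_sol :: "'s \<Rightarrow> real^3 \<Rightarrow> real^3"
    and discretize :: "(real^3 \<Rightarrow> real^3) \<Rightarrow> real^3 \<Rightarrow> real^3"
    and X :: "real^'s^'w"
    and M K :: "real^'w^'w"
  assumes domain: "lipschitz_domain \<Omega>" "simply_connected \<Omega>"
    and basis: "\<And>i. w i \<in> H_curl \<Omega>" "\<And>i. vanishing_tangential_trace \<Omega> (w i)"
      "lin_indep_fields \<Omega> w"
    and \<nu>_pos: "\<nu> > 0"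
    and conductor: "subdomain \<Omega>c \<Omega>" "\<sigma>c > 0"
    and M_eq: "M = mass_matrix \<Omega> (conductivity \<Omega>c \<sigma>c) w"
    and K_eq: "K = curl_curl_matrix \<Omega> \<nu> w"
    and regular: "regular_pencil M K"
    and solid: "\<And>k. subdomain (\<Omega>sol k) \<Omega>c" "disjoint_family \<Omega>sol"
    and chi_support: "\<And>k x. x \<notin> \<Omega>sol k \<Longrightarrow> chi_sol k x = 0"
    and X_columns: "\<And>k. AE x in lebesgue_on \<Omega>.
      discretize (chi_sol k) x = (\<Sum>i\<in>UNIV. (X $ i $ k) *\<^sub>R w i x)"
    and time: "t0 < tf"
  shows "fits_into_structure t0 tf (solid_unknown :: 'w + 's \<Rightarrow> unknown)
    (\<lambda>z \<iota>. solid_conductor_model t0 tf M K X (\<lambda>t. a_part (z t)) (\<lambda>t. v_part (z t)) \<iota>)"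
proof -
  have M: "transpose M = M" and K: "transpose K = K"
    by (simp_all add: M_eq K_eq transpose_mass_matrix transpose_curl_curl_matrix)
  have "open \<Omega>" "open \<Omega>c"
    using domain(1) conductor(1) by (auto simp: lipschitz_domain_def subdomain_def)
  \<comment> \<open>The conductivity takes only the values 0 and \<sigma>c > 0, so it is nonnegative
    and bounded by \<sigma>c.\<close>
  then have M_psd: "positive_semidefinite M"
    unfolding M_eq using basis(1) conductor(2)
    by (intro positive_semidefinite_mass_matrix[where C = \<sigma>c] borel_measurable_conductivity)
      (auto simp: H_curl_def conductivity_def)
  let ?\<gamma> = "solid_grouping \<circ> (solid_unknown :: 'w + 's \<Rightarrow> unknown)"
  let ?S = "solid_energy_matrix K :: real^('w + 's)^('w + 's)"
  have C1: "C1_function (\<lambda>x. (x \<bullet> (?S *v x)) / 2)"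
    by (intro C1_function_quadratic_form transpose_solid_energy_matrix K)
  \<comment> \<open>The padded quadratic form sees its argument only through \<open>a_part\<close>,
    whose coordinates all lie in \<open>Z1\<close>.\<close>
  have dep: "depends_on_z1_z2 ?\<gamma> (\<lambda>x. (x \<bullet> (?S *v x)) / 2)"
    unfolding depends_on_z1_z2_def
  proof (intro allI impI)
    fix x y :: "real^('w + 's)"
    assume "\<forall>p. ?\<gamma> p \<noteq> Z3 \<longrightarrow> x $ p = y $ p"
    then have "a_part x = a_part y"
      by (simp add: a_part_def vec_eq_iff)
    then show "(x \<bullet> (?S *v x)) / 2 = (y \<bullet> (?S *v y)) / 2"
      by (simp add: solid_energy_matrix_def inner_block_matrix_vector_mult)
  qed
  \<comment> \<open>Skew-symmetry of the choice \<open>J = 0\<close>: the whole coupling between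
    \<open>a\<close> and \<open>v\<close> sits in the dissipation matrix.\<close>
  have "(0 :: real^('w + 's)^('w + 's)) = - transpose 0"
    by (simp add: transpose_zero)
  then show ?thesis
    unfolding fits_into_structure_def
    using dep C1 transpose_solid_dissipation[OF M, of X, symmetric]
      positive_semidefinite_solid_dissipation[OF M_psd, of X]
      solid_conductor_model_iff_structured_system[OF M K]
    by blast
qed

end
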